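(* Let $n\ge 2$ and let $H=(V,E)$ be an $n$-uniform hypergraph. For $v\in V$ let $d_v$ be the degree of $v$ (the number of edges containing $v$), and for $I\subseteq V$ let $d(I)=\sum_{v\in I} d_v$. Then there is an independent set $I\subseteq V$ such that \[ d(I)\ge \frac{n-1}{n}\sum_{v\in V,\ d_v>0} d_v^{\frac{n-2}{n-1}}. \]
   Context: A hypergraph $H=(V,E)$ consists of a finite vertex set $V$ and a family $E$ of subsets of $V$ (edges); it is $n$-uniform if every edge has exactly $n$ elements. A set $I\subseteq V$ is independent if it contains no edge of $H$. *)

theory Defs
  imports Complex_Main
begin

definition hypergraph :: "'a set \<Rightarrow> 'a set set \<Rightarrow> bool" where
  "hypergraph V E \<longleftrightarrow> finite V \<and> (\<forall>e\<in>E. e \<subseteq> V)"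

definition uniform_edges :: "nat \<Rightarrow> 'a set set \<Rightarrow> bool" where
  "uniform_edges n E \<longleftrightarrow> (\<forall>e\<in>E. card e = n)"

definition independent_set :: "'a set \<Rightarrow> 'a set set \<Rightarrow> 'a set \<Rightarrow> bool" where
  "independent_set V E I \<longleftrightarrow> I \<subseteq> V \<and> (\<forall>e\<in>E. \<not> e \<subseteq> I)"

definition hdegree :: "'a set set \<Rightarrow> 'a \<Rightarrow> nat" where
  "hdegree E v = card {e \<in> E. v \<in> e}"

definition hdegree_sum :: "'a set set \<Rightarrow> 'a set \<Rightarrow> nat" where
  "hdegree_sum E I = (\<Sum>v\<in>I. hdegree E v)"

end

theory Submission
  imports Defs "HOL-Probability.Product_PMF"
begin

text \<open>
  Choose every vertex \<open>v\<close> of positive degree \<open>d v\<close> independently with probability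
  \<open>p v = d v powr (-1/(n-1))\<close>, and delete from each edge inside the chosen set a vertex
  of minimum degree. The expected degree sum before the deletion is
  \<open>S = (\<Sum>v. d v powr ((n-2)/(n-1)))\<close>. If \<open>m\<close> is the minimum degree in an edge \<open>e\<close>, then
  for every \<open>u \<in> e\<close> the product of the \<open>n - 1\<close> numbers \<open>p v\<close>, \<open>v \<in> e - {u}\<close>, is at most
  \<open>1 / m\<close>, so the expected loss \<open>m * (\<Prod>v\<in>e. p v)\<close> at \<open>e\<close> is at most \<open>p u\<close>. Averaging over
  \<open>u \<in> e\<close> and summing over the edges bounds the expected total loss by \<open>S / n\<close>.
\<close>

lemma exists_ge_expectation_pmf:
  fixes f :: "'a \<Rightarrow> real"
  assumes "integrable (measure_pmf M) f"
  shows "\<exists>x\<in>set_pmf M. measure_pmf.expectation M f \<le> f x"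
proof (rule ccontr)
  assume "\<not> ?thesis"
  then have "AE x in measure_pmf M. f x < measure_pmf.expectation M f"
    by (simp add: AE_measure_pmf_iff not_le)
  then show False
    using measure_pmf.expectation_less[OF assms] by blast
qed

definition random_subset_pmf :: "'a set \<Rightarrow> ('a \<Rightarrow> real) \<Rightarrow> 'a set pmf" where
  "random_subset_pmf V p =
    map_pmf (\<lambda>chosen. {v \<in> V. chosen v}) (Pi_pmf V False (\<lambda>v. bernoulli_pmf (p v)))"

lemma set_random_subset_pmf_subset: "set_pmf (random_subset_pmf V p) \<subseteq> Pow V"
  by (auto simp: random_subset_pmf_def)

lemma integrable_random_subset_pmf:
  fixes f :: "'a set \<Rightarrow> real"
  assumes "finite V"
  shows "integrable (measure_pmf (random_subset_pmf V p)) f"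
  using finite_subset[OF set_random_subset_pmf_subset] assms
  by (intro integrable_measure_pmf_finite) simp

lemma prob_superset_random_subset_pmf_subset:
  assumes "finite V" "A \<subseteq> V" and p: "\<And>v. v \<in> V \<Longrightarrow> 0 \<le> p v \<and> p v \<le> 1"
  shows "measure_pmf.prob (random_subset_pmf V p) {I. A \<subseteq> I} = prod p A"
proof -
  let ?allowed = "\<lambda>v. if v \<in> A then {True} else UNIV"
  have "(\<lambda>chosen. {v \<in> V. chosen v}) -` {I. A \<subseteq> I} = Pi V ?allowed"
    using \<open>A \<subseteq> V\<close> by (auto simp: Pi_iff split: if_splits)
  then have "measure_pmf.prob (random_subset_pmf V p) {I. A \<subseteq> I} =
      (\<Prod>v\<in>V. measure_pmf.prob (bernoulli_pmf (p v)) (?allowed v))"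
    using \<open>finite V\<close> by (simp add: random_subset_pmf_def measure_Pi_pmf_Pi)
  also have "\<dots> = (\<Prod>v\<in>V. if v \<in> A then p v else 1)"
    using p by (intro prod.cong) (auto simp: measure_pmf_single)
  also have "\<dots> = prod p A"
    using assms(1,2) by (simp add: prod.If_cases Int_absorb1)
  finally show ?thesis .
qed

lemma expectation_sum_contained_random_subset_pmf:
  fixes c :: "'i \<Rightarrow> real"
  assumes "finite V" "finite K" "\<And>k. k \<in> K \<Longrightarrow> A k \<subseteq> V"
    and "\<And>v. v \<in> V \<Longrightarrow> 0 \<le> p v \<and> p v \<le> 1"
  shows "measure_pmf.expectation (random_subset_pmf V p) (\<lambda>I. \<Sum>k\<in>{k \<in> K. A k \<subseteq> I}. c k) =
    (\<Sum>k\<in>K. c k * prod p (A k))"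
proof -
  have "(\<Sum>k\<in>{k \<in> K. A k \<subseteq> I}. c k) = (\<Sum>k\<in>K. c k * indicator {I. A k \<subseteq> I} I)" for I
    using \<open>finite K\<close> by (simp add: Int_def)
  then have "measure_pmf.expectation (random_subset_pmf V p) (\<lambda>I. \<Sum>k\<in>{k \<in> K. A k \<subseteq> I}. c k) =
      (\<Sum>k\<in>K. c k * measure_pmf.prob (random_subset_pmf V p) {I. A k \<subseteq> I})"
    using \<open>finite V\<close> by (simp add: integrable_random_subset_pmf)
  then show ?thesis
    using assms by (simp add: prob_superset_random_subset_pmf_subset)
qed

lemma expectation_sum_random_subset_pmf:
  fixes w :: "'a \<Rightarrow> real"
  assumes "finite V" "\<And>v. v \<in> V \<Longrightarrow> 0 \<le> p v \<and> p v \<le> 1"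
  shows "measure_pmf.expectation (random_subset_pmf V p) (sum w) = (\<Sum>v\<in>V. w v * p v)"
proof -
  have "measure_pmf.expectation (random_subset_pmf V p) (sum w) =
      measure_pmf.expectation (random_subset_pmf V p) (\<lambda>I. \<Sum>v\<in>{v \<in> V. {v} \<subseteq> I}. w v)"
  proof (rule integral_cong_AE)
    have "sum w I = (\<Sum>v\<in>{v \<in> V. {v} \<subseteq> I}. w v)" if "I \<subseteq> V" for I
      using that by (intro sum.cong) auto
    then show "AE I in measure_pmf (random_subset_pmf V p).
        sum w I = (\<Sum>v\<in>{v \<in> V. {v} \<subseteq> I}. w v)"
      using set_random_subset_pmf_subset[of V p] unfolding AE_measure_pmf_iff by blast
  qed simp_all
  also have "\<dots> = (\<Sum>v\<in>V. w v * p v)"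
    using assms expectation_sum_contained_random_subset_pmf[of V V "\<lambda>v. {v}" p w] by simp
  finally show ?thesis .
qed

lemma hypergraph_finite_edges: "hypergraph V E \<Longrightarrow> finite E"
  by (auto simp: hypergraph_def intro: finite_subset[of E "Pow V"])

lemma independent_set_by_deletion:
  fixes w :: "'a \<Rightarrow> 'b::linordered_ab_group_add"
  assumes "hypergraph V E" "{} \<notin> E" "I \<subseteq> V" and w_nonneg: "\<And>v. v \<in> V \<Longrightarrow> 0 \<le> w v"
  shows "\<exists>J. independent_set V E J \<and> sum w I - (\<Sum>e\<in>{e \<in> E. e \<subseteq> I}. Min (w ` e)) \<le> sum w J"
proof -
  let ?inside = "{e \<in> E. e \<subseteq> I}"
  have "finite I"
    using assms(1,3) finite_subset by (auto simp: hypergraph_def)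
  have "finite ?inside"
    using hypergraph_finite_edges[OF assms(1)] by simp
  have "Min (w ` e) \<in> w ` e" if "e \<in> ?inside" for e
    using that \<open>{} \<notin> E\<close> finite_subset[OF _ \<open>finite I\<close>] by (intro Min_in) auto
  then have "\<forall>e\<in>?inside. \<exists>v. v \<in> e \<and> w v = Min (w ` e)"
    by (fastforce simp: image_iff)
  from bchoice[OF this] obtain cheapest
    where cheapest_in: "\<And>e. e \<in> ?inside \<Longrightarrow> cheapest e \<in> e"
      and w_cheapest: "\<And>e. e \<in> ?inside \<Longrightarrow> w (cheapest e) = Min (w ` e)"
    by blast
  have removed: "cheapest ` ?inside \<subseteq> I"
    using cheapest_in by blast
  have "sum w (cheapest ` ?inside) \<le> (\<Sum>e\<in>?inside. w (cheapest e))"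
    using sum_image_le[of ?inside w cheapest] \<open>finite ?inside\<close> removed \<open>I \<subseteq> V\<close> w_nonneg
    by (auto simp: o_def)
  also have "\<dots> = (\<Sum>e\<in>?inside. Min (w ` e))"
    using w_cheapest by (rule sum.cong[OF refl])
  finally have "sum w I - (\<Sum>e\<in>?inside. Min (w ` e)) \<le> sum w (I - cheapest ` ?inside)"
    using sum_diff[OF \<open>finite I\<close> removed, of w] by (simp add: diff_left_mono)
  moreover have "independent_set V E (I - cheapest ` ?inside)"
    using cheapest_in \<open>I \<subseteq> V\<close> unfolding independent_set_def by blast
  ultimately show ?thesis
    by blast
qed

lemma independent_set_by_alteration:
  fixes w p :: "'a \<Rightarrow> real"
  assumes "hypergraph V E" "{} \<notin> E" "\<And>v. v \<in> V \<Longrightarrow> 0 \<le> w v"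
    and p: "\<And>v. v \<in> V \<Longrightarrow> 0 \<le> p v \<and> p v \<le> 1"
  shows "\<exists>J. independent_set V E J \<and>
    (\<Sum>v\<in>V. w v * p v) - (\<Sum>e\<in>E. Min (w ` e) * prod p e) \<le> sum w J"
proof -
  let ?M = "random_subset_pmf V p"
  let ?loss = "\<lambda>I. \<Sum>e\<in>{e \<in> E. e \<subseteq> I}. Min (w ` e)"
  have "finite V" and edges: "\<And>e. e \<in> E \<Longrightarrow> e \<subseteq> V"
    using assms(1) by (auto simp: hypergraph_def)
  have "measure_pmf.expectation ?M (\<lambda>I. sum w I - ?loss I) =
      measure_pmf.expectation ?M (sum w) - measure_pmf.expectation ?M ?loss"
    using \<open>finite V\<close> by (simp add: integrable_random_subset_pmf)
  also have "measure_pmf.expectation ?M (sum w) = (\<Sum>v\<in>V. w v * p v)"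
    using \<open>finite V\<close> p by (rule expectation_sum_random_subset_pmf)
  also have "measure_pmf.expectation ?M ?loss = (\<Sum>e\<in>E. Min (w ` e) * prod p e)"
    using \<open>finite V\<close> edges p hypergraph_finite_edges[OF assms(1)]
    by (intro expectation_sum_contained_random_subset_pmf)
  finally obtain I where "I \<in> set_pmf ?M"
    and I_ge: "(\<Sum>v\<in>V. w v * p v) - (\<Sum>e\<in>E. Min (w ` e) * prod p e) \<le> sum w I - ?loss I"
    using exists_ge_expectation_pmf[of ?M "\<lambda>I. sum w I - ?loss I"] \<open>finite V\<close>
    by (auto simp: integrable_random_subset_pmf)
  then have "I \<subseteq> V"
    using set_random_subset_pmf_subset by blast
  then show ?thesis
    using independent_set_by_deletion[OF assms(1,2), of I w] assms(3) I_ge order_trans by blast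
qed

lemma sum_edges_eq_sum_hdegree:
  fixes f :: "'a \<Rightarrow> 'b::comm_semiring_1"
  assumes "hypergraph V E"
  shows "(\<Sum>e\<in>E. \<Sum>v\<in>e. f v) = (\<Sum>v\<in>V. of_nat (hdegree E v) * f v)"
proof -
  have "(\<Sum>e\<in>E. \<Sum>v\<in>e. f v) = (\<Sum>e\<in>E. \<Sum>v\<in>{v \<in> V. v \<in> e}. f v)"
    using assms by (intro sum.cong) (auto simp: hypergraph_def)
  also have "\<dots> = (\<Sum>v\<in>V. \<Sum>e\<in>{e \<in> E. v \<in> e}. f v)"
    using assms hypergraph_finite_edges by (intro sum.swap_restrict) (auto simp: hypergraph_def)
  finally show ?thesis
    by (simp add: hdegree_def)
qed

lemma Min_mult_prod_powr_le_member:
  fixes d :: "'a \<Rightarrow> real"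
  assumes "card e \<ge> 2" "u \<in> e" and pos: "\<And>v. v \<in> e \<Longrightarrow> d v > 0"
  shows "Min (d ` e) * (\<Prod>v\<in>e. d v powr (- 1 / (real (card e) - 1)))
    \<le> d u powr (- 1 / (real (card e) - 1))"
proof -
  let ?p = "\<lambda>x. x powr (- 1 / (real (card e) - 1))"
  let ?m = "Min (d ` e)"
  have "finite e"
    using assms(1) by (auto intro: card_ge_0_finite)
  then have "?m > 0"
    using assms(2) pos by (subst Min_gr_iff) auto
  have "(\<Prod>v\<in>e - {u}. ?p (d v)) \<le> (\<Prod>v\<in>e - {u}. ?p ?m)"
    using assms(1) \<open>finite e\<close> \<open>?m > 0\<close> by (intro prod_mono conjI powr_mono2') auto
  also have "\<dots> = ?p ?m ^ (card e - 1)"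
    using assms(2) \<open>finite e\<close> by simp
  also have "\<dots> = ?m powr - 1"
    using assms(1) \<open>?m > 0\<close> by (simp add: powr_power)
  finally have "?m * (\<Prod>v\<in>e - {u}. ?p (d v)) \<le> 1"
    using \<open>?m > 0\<close> by (simp add: powr_minus field_simps)
  then have "?p (d u) * (?m * (\<Prod>v\<in>e - {u}. ?p (d v))) \<le> ?p (d u)"
    by (intro mult_left_le) auto
  then show ?thesis
    using assms(2) \<open>finite e\<close> by (simp add: prod.remove[of e u] mult.left_commute)
qed

lemma Min_mult_prod_powr_le_average:
  fixes d :: "'a \<Rightarrow> real"
  assumes "card e \<ge> 2" "\<And>v. v \<in> e \<Longrightarrow> d v > 0"
  shows "Min (d ` e) * (\<Prod>v\<in>e. d v powr (- 1 / (real (card e) - 1)))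
    \<le> (\<Sum>v\<in>e. d v powr (- 1 / (real (card e) - 1))) / card e"
  using sum_bounded_below[OF Min_mult_prod_powr_le_member[OF assms(1) _ assms(2)]] assms(1)
  by (simp add: field_simps)

definition inclusion_prob :: "nat \<Rightarrow> 'a set set \<Rightarrow> 'a \<Rightarrow> real" where
  "inclusion_prob n E v = real (hdegree E v) powr (- 1 / (real n - 1))"

lemma inclusion_prob_bounds:
  assumes "n \<ge> 2"
  shows "0 \<le> inclusion_prob n E v \<and> inclusion_prob n E v \<le> 1"
proof (cases "hdegree E v = 0")
  case False
  then show ?thesis
    using powr_mono2'[of "- 1 / (real n - 1)" 1 "hdegree E v"] assms
    by (simp add: inclusion_prob_def)
qed (simp add: inclusion_prob_def)

lemma sum_hdegree_mult_inclusion_prob: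
  assumes "n \<ge> 2" "finite V"
  shows "(\<Sum>v\<in>V. real (hdegree E v) * inclusion_prob n E v) =
    (\<Sum>v\<in>{v \<in> V. hdegree E v > 0}. real (hdegree E v) powr ((real n - 2) / (real n - 1)))"
proof -
  have "1 + - 1 / (real n - 1) = (real n - 2) / (real n - 1)"
    using assms(1) by (simp add: field_simps)
  then have "real (hdegree E v) * inclusion_prob n E v =
      real (hdegree E v) powr ((real n - 2) / (real n - 1))" for v
    using powr_mult_base[of "real (hdegree E v)" "- 1 / (real n - 1)"]
    by (simp add: inclusion_prob_def)
  then show ?thesis
    using assms(2) by (intro sum.mono_neutral_cong_right) auto
qed

lemma sum_edges_Min_hdegree_mult_prod_inclusion_prob_le:
  assumes "n \<ge> 2" "hypergraph V E" "uniform_edges n E"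
  shows "(\<Sum>e\<in>E. (MIN v\<in>e. real (hdegree E v)) * prod (inclusion_prob n E) e)
    \<le> (\<Sum>v\<in>V. real (hdegree E v) * inclusion_prob n E v) / real n"
proof -
  have "(MIN v\<in>e. real (hdegree E v)) * prod (inclusion_prob n E) e
      \<le> (\<Sum>v\<in>e. inclusion_prob n E v) / real n" if "e \<in> E" for e
  proof -
    have "hdegree E v > 0" if "v \<in> e" for v
      using that \<open>e \<in> E\<close> hypergraph_finite_edges[OF assms(2)]
      by (auto simp: hdegree_def card_gt_0_iff)
    moreover have "card e = n"
      using assms(3) that by (simp add: uniform_edges_def)
    ultimately show ?thesis
      using Min_mult_prod_powr_le_average[of e "\<lambda>v. real (hdegree E v)"] assms(1)
      by (simp add: inclusion_prob_def)
  qed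
  then have "(\<Sum>e\<in>E. (MIN v\<in>e. real (hdegree E v)) * prod (inclusion_prob n E) e)
      \<le> (\<Sum>e\<in>E. (\<Sum>v\<in>e. inclusion_prob n E v) / real n)"
    by (rule sum_mono)
  then show ?thesis
    using sum_edges_eq_sum_hdegree[OF assms(2), of "inclusion_prob n E"]
    by (simp flip: sum_divide_distrib)
qed

theorem theorem2:
  fixes n :: nat and V :: "'a set" and E :: "'a set set"
  assumes "n \<ge> 2"
    and "hypergraph V E"
    and "uniform_edges n E"
  shows "\<exists>I. independent_set V E I \<and>
    real (hdegree_sum E I) \<ge>
      (real n - 1) / real n *
        (\<Sum>v\<in>{v \<in> V. hdegree E v > 0}. real (hdegree E v) powr ((real n - 2) / (real n - 1)))"
proof -
  let ?d = "\<lambda>v. real (hdegree E v)" and ?p = "inclusion_prob n E"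
  let ?S = "\<Sum>v\<in>V. ?d v * ?p v"
  have "{} \<notin> E"
    using assms(1,3) by (auto simp: uniform_edges_def)
  then obtain I where "independent_set V E I"
    and I_ge: "?S - (\<Sum>e\<in>E. (MIN v\<in>e. ?d v) * prod ?p e) \<le> (\<Sum>v\<in>I. ?d v)"
    using independent_set_by_alteration[OF assms(2), of ?d ?p] inclusion_prob_bounds[OF assms(1)]
    by fastforce
  have "finite V"
    using assms(2) by (simp add: hypergraph_def)
  have "(real n - 1) / real n * ?S = ?S - ?S / real n"
    using assms(1) by (simp add: field_simps)
  also have "\<dots> \<le> hdegree_sum E I"
    using I_ge sum_edges_Min_hdegree_mult_prod_inclusion_prob_le[OF assms]
    by (simp add: hdegree_sum_def)
  finally show ?thesis
    using \<open>independent_set V E I\<close> sum_hdegree_mult_inclusion_prob[OF assms(1) \<open>finite V\<close>, of E]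
    by auto
qed

end
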